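(* Let $G=(V,E,\nu,\mu)$ be a weighted graph and let $\Omega$ be a finite subset of $V$. Then $$\lambda_{1,1}(\Omega)=h_{\mu,\nu}(\Omega),$$ where $\lambda_{1,1}(\Omega)$ is the first eigenvalue of the Dirichlet $1$-Laplacian on $\Omega$ and $h_{\mu,\nu}(\Omega)$ is the Dirichlet Cheeger constant of $\Omega$.
   Context: A weighted graph $G=(V,E,\nu,\mu)$ consists of a locally finite, simple, undirected graph $(V,E)$, an edge weight $\mu:E\to(0,\infty)$, $\{x,y\}\mapsto\mu_{xy}=\mu_{yx}$, extended by $\mu_{xy}=0$ if $\{x,y\}\notin E$, and a vertex measure $\nu:V\to(0,\infty)$, $x\mapsto\nu_x$. Write $x\sim y$ if $\{x,y\}\in E$. The subset $\Omega$ is nonempty. For $u\in\mathbb{R}^\Omega$ (functions $\Omega\to\mathbb{R}$), $\bar u\in\mathbb{R}^V$ is the extension of $u$ by $0$ to $V$. The first eigenvalue of the Dirichlet $1$-Laplacian is given by the Rayleigh quotient $$\lambda_{1,1}(\Omega)=\inf_{u\in\mathbb{R}^\Omega,\,u\not\equiv0}\frac{E_1(u)}{\|u\|_{1,\Omega}},\quad E_1(u)=\frac12\sum_{x,y\in V,\,x\sim y}|\bar u(y)-\bar u(x)|\mu_{xy},\quad \|u\|_{1,\Omega}=\sum_{x\in\Omega}|u(x)|\nu_x,$$ where the sum in $E_1$ is over ordered pairs. For $U\subset V$, $\partial U=\{\{x,y\}\in E:x\in U,\,y\in V\setminus U\}$, $|\partial U|_\mu=\sum_{\{x,y\}\in\partial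 U}\mu_{xy}$, $|U|_\nu=\sum_{x\in U}\nu_x$. The (Dirichlet) Cheeger constant of the finite set $\Omega$ is $$h_{\mu,\nu}(\Omega)=\min_{\emptyset\ne U\subset\Omega}\frac{|\partial U|_\mu}{|U|_\nu}.$$ *)

theory Defs
  imports "HOL-Analysis.Analysis"
begin

text \<open>
  Edges are two-element sets of vertices, so the weight \<open>\<mu> {x, y}\<close> is symmetric by
  construction. All sums below range over edges only; hence the values of \<open>\<mu>\<close>
  outside \<open>E\<close> never matter, and extending \<open>\<mu>\<close> by zero is not needed.
  The vertex set may be infinite.
\<close>

locale weighted_graph =
  fixes V :: "'a set" and E :: "'a set set" and \<nu> :: "'a \<Rightarrow> real" and \<mu> :: "'a set \<Rightarrow> real"
  assumes simple_graph: "e \<in> E \<Longrightarrow> \<exists>x\<in>V. \<exists>y\<in>V. x \<noteq> y \<and> e = {x, y}"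
    and locally_finite: "x \<in> V \<Longrightarrow> finite {y \<in> V. {x, y} \<in> E}"
    and vertex_measure_pos: "x \<in> V \<Longrightarrow> \<nu> x > 0"
    and edge_weight_pos: "e \<in> E \<Longrightarrow> \<mu> e > 0"

definition zero_ext :: "'a set \<Rightarrow> ('a \<Rightarrow> real) \<Rightarrow> 'a \<Rightarrow> real" where
  "zero_ext \<Omega> u x = (if x \<in> \<Omega> then u x else 0)"

definition ordered_adj_pairs :: "'a set \<Rightarrow> 'a set set \<Rightarrow> ('a \<times> 'a) set" where
  "ordered_adj_pairs V E = {(x, y). x \<in> V \<and> y \<in> V \<and> {x, y} \<in> E}"

text \<open>
  The index set may be infinite, but for finite \<open>\<Omega>\<close> only finitely many terms are nonzero
  (see \<open>energy1_finite_support\<close>), so the infinite sum is a genuine finite one.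
\<close>

definition energy1 :: "'a set \<Rightarrow> 'a set set \<Rightarrow> ('a set \<Rightarrow> real) \<Rightarrow> 'a set \<Rightarrow> ('a \<Rightarrow> real) \<Rightarrow> real" where
  "energy1 V E \<mu> \<Omega> u = 1 / 2 *
     (\<Sum>\<^sub>\<infinity>(x, y)\<in>ordered_adj_pairs V E. \<bar>zero_ext \<Omega> u y - zero_ext \<Omega> u x\<bar> * \<mu> {x, y})"

definition norm1 :: "('a \<Rightarrow> real) \<Rightarrow> 'a set \<Rightarrow> ('a \<Rightarrow> real) \<Rightarrow> real" where
  "norm1 \<nu> \<Omega> u = (\<Sum>x\<in>\<Omega>. \<bar>u x\<bar> * \<nu> x)"

text \<open>
  The extensional function space \<open>\<Omega> \<rightarrow>\<^sub>E UNIV\<close> represents the functions from \<open>\<Omega>\<close> to the reals.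
\<close>

definition dirichlet_lambda11 ::
    "'a set \<Rightarrow> 'a set set \<Rightarrow> ('a \<Rightarrow> real) \<Rightarrow> ('a set \<Rightarrow> real) \<Rightarrow> 'a set \<Rightarrow> real" where
  "dirichlet_lambda11 V E \<nu> \<mu> \<Omega> =
     (INF u \<in> {u \<in> \<Omega> \<rightarrow>\<^sub>E UNIV. \<exists>x\<in>\<Omega>. u x \<noteq> 0}. energy1 V E \<mu> \<Omega> u / norm1 \<nu> \<Omega> u)"

definition edge_boundary :: "'a set \<Rightarrow> 'a set set \<Rightarrow> 'a set \<Rightarrow> 'a set set" where
  "edge_boundary V E U = {e \<in> E. \<exists>x y. e = {x, y} \<and> x \<in> U \<and> y \<in> V - U}"

definition cheeger_constant ::
    "'a set \<Rightarrow> 'a set set \<Rightarrow> ('a \<Rightarrow> real) \<Rightarrow> ('a set \<Rightarrow> real) \<Rightarrow> 'a set \<Rightarrow> real" where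
  "cheeger_constant V E \<nu> \<mu> \<Omega> =
     (MIN U \<in> {U. U \<noteq> {} \<and> U \<subseteq> \<Omega>}. (\<Sum>e\<in>edge_boundary V E U. \<mu> e) / (\<Sum>x\<in>U. \<nu> x))"

context weighted_graph
begin

lemma energy1_finite_support:
  assumes "finite \<Omega>" "\<Omega> \<subseteq> V"
  shows "finite {(x, y) \<in> ordered_adj_pairs V E.
           \<bar>zero_ext \<Omega> u y - zero_ext \<Omega> u x\<bar> * \<mu> {x, y} \<noteq> 0}"
proof -
  let ?S = "Sigma \<Omega> (\<lambda>x. {y \<in> V. {x, y} \<in> E})"
  have S: "finite ?S"
    using assms locally_finite by (intro finite_SigmaI) auto
  then have "finite (?S \<union> prod.swap ` ?S)"
    by simp
  moreover have "(x, y) \<in> ?S \<union> prod.swap ` ?S"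
    if "(x, y) \<in> ordered_adj_pairs V E" "\<bar>zero_ext \<Omega> u y - zero_ext \<Omega> u x\<bar> * \<mu> {x, y} \<noteq> 0" for x y
  proof (cases "x \<in> \<Omega>")
    case True
    then show ?thesis using that(1) by (auto simp: ordered_adj_pairs_def)
  next
    case False
    then have "y \<in> \<Omega>" using that(2) by (auto simp: zero_ext_def split: if_splits)
    then have "(y, x) \<in> ?S" using that(1) by (auto simp: ordered_adj_pairs_def insert_commute)
    then have "prod.swap (y, x) \<in> prod.swap ` ?S" by (rule imageI)
    then show ?thesis by simp
  qed
  ultimately show ?thesis
    by (rule_tac finite_subset[where B = "?S \<union> prod.swap ` ?S"]) blast+
qed

lemma finite_edge_boundary:
  assumes "finite U" "U \<subseteq> V"
  shows "finite (edge_boundary V E U)"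
proof -
  have "edge_boundary V E U \<subseteq> (\<lambda>(x, y). {x, y}) ` Sigma U (\<lambda>x. {y \<in> V. {x, y} \<in> E})"
    by (auto simp: edge_boundary_def)
  moreover have "finite (Sigma U (\<lambda>x. {y \<in> V. {x, y} \<in> E}))"
    using assms locally_finite by (intro finite_SigmaI) auto
  ultimately show ?thesis
    using finite_subset by blast
qed

end

end

theory Submission
  imports Defs
begin

text \<open>
  Indicator functions show that the Rayleigh infimum is at most the Cheeger constant \<open>h\<close>: the
  indicator of \<open>U \<subseteq> \<Omega>\<close> has energy \<open>|\<partial>U|\<close>, because every boundary edge contributes two ordered
  pairs and the energy carries the factor \<open>1 / 2\<close> (\<open>energy1_indicator\<close>), and it has norm \<open>|U|\<close>.

  The converse needs \<open>h * norm1 \<nu> \<Omega> u \<le> energy1 V E \<mu> \<Omega> u\<close> for every \<open>u\<close>. Replacing \<open>u\<close> by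
  its absolute value keeps the norm and does not increase the energy, so \<open>u \<ge> 0\<close> may be assumed.
  Such a \<open>u\<close> is a nonnegative combination of indicators of its nested superlevel sets, and both
  sides are additive along this decomposition: this is the discrete coarea formula. It is used here
  in the form of an induction that removes one layer at a time: if \<open>U\<close> is the support of \<open>u\<close> and
  \<open>m\<close> its least positive value, then passing from \<open>u\<close> to \<open>u - m * indicator U\<close> lowers the energy
  by exactly \<open>m |\<partial>U|\<close> (\<open>energy1_remove_layer\<close>) and the norm by exactly \<open>m |U|\<close>, while
  \<open>h |U| \<le> |\<partial>U|\<close> by the definition of \<open>h\<close>. The support shrinks strictly, which ends the induction.
\<close>

definition incident_pairs :: "'a set \<Rightarrow> 'a set set \<Rightarrow> 'a set \<Rightarrow> ('a \<times> 'a) set" where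
  "incident_pairs V E \<Omega> = {(x, y) \<in> ordered_adj_pairs V E. x \<in> \<Omega> \<or> y \<in> \<Omega>}"

lemma norm1_indicator:
  assumes "finite \<Omega>" "U \<subseteq> \<Omega>"
  shows "norm1 \<nu> \<Omega> (indicator U) = (\<Sum>x\<in>U. \<nu> x)"
proof -
  have "norm1 \<nu> \<Omega> (indicator U) = (\<Sum>x\<in>\<Omega>. if x \<in> U then \<nu> x else 0)"
    unfolding norm1_def by (intro sum.cong) (auto simp: indicator_def)
  also have "\<dots> = (\<Sum>x\<in>U. \<nu> x)"
    using assms by (simp add: sum.If_cases Int_absorb1)
  finally show ?thesis .
qed

lemma norm1_remove_layer:
  assumes "finite \<Omega>" "U \<subseteq> \<Omega>" "0 \<le> m"
    and "\<And>x. x \<in> U \<Longrightarrow> m \<le> u x"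
  shows "norm1 \<nu> \<Omega> u = m * (\<Sum>x\<in>U. \<nu> x) + norm1 \<nu> \<Omega> (\<lambda>x. u x - m * indicator U x)"
proof -
  have "\<bar>u x\<bar> = m * \<bar>indicator U x\<bar> + \<bar>u x - m * indicator U x\<bar>" for x
    using assms(3) assms(4)[of x] by (cases "x \<in> U") auto
  then have "norm1 \<nu> \<Omega> u
      = m * norm1 \<nu> \<Omega> (indicator U) + norm1 \<nu> \<Omega> (\<lambda>x. u x - m * indicator U x)"
    by (simp add: norm1_def sum_distrib_left sum.distrib[symmetric] algebra_simps)
  then show ?thesis
    by (simp only: norm1_indicator[OF assms(1,2)])
qed

lemma cheeger_constant_attained:
  assumes "finite \<Omega>" "\<Omega> \<noteq> {}"
  obtains U where "U \<noteq> {}" "U \<subseteq> \<Omega>"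
    "cheeger_constant V E \<nu> \<mu> \<Omega> = (\<Sum>e\<in>edge_boundary V E U. \<mu> e) / (\<Sum>x\<in>U. \<nu> x)"
proof -
  have "cheeger_constant V E \<nu> \<mu> \<Omega>
      \<in> (\<lambda>U. (\<Sum>e\<in>edge_boundary V E U. \<mu> e) / (\<Sum>x\<in>U. \<nu> x)) ` {U. U \<noteq> {} \<and> U \<subseteq> \<Omega>}"
    unfolding cheeger_constant_def using assms by (intro Min_in) auto
  then show ?thesis
    using that by auto
qed

context weighted_graph
begin

lemma finite_incident_pairs:
  assumes "finite \<Omega>" "\<Omega> \<subseteq> V"
  shows "finite (incident_pairs V E \<Omega>)"
proof -
  let ?S = "Sigma \<Omega> (\<lambda>x. {y \<in> V. {x, y} \<in> E})"
  have "finite ?S"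
    using assms locally_finite by (intro finite_SigmaI) auto
  moreover have "incident_pairs V E \<Omega> \<subseteq> ?S \<union> ?S\<inverse>"
    by (auto simp: incident_pairs_def ordered_adj_pairs_def insert_commute)
  ultimately show ?thesis
    by (simp add: finite_subset)
qed

text \<open>
  Only pairs that meet \<open>\<Omega>\<close> can contribute, whatever the function is. A common finite index set for
  all functions makes energies comparable term by term.
\<close>

lemma energy1_eq_finite_sum:
  assumes "finite \<Omega>" "\<Omega> \<subseteq> V"
  shows "energy1 V E \<mu> \<Omega> u =
    1 / 2 * (\<Sum>(x, y)\<in>incident_pairs V E \<Omega>. \<bar>zero_ext \<Omega> u y - zero_ext \<Omega> u x\<bar> * \<mu> {x, y})"
proof -
  let ?f = "\<lambda>(x, y). \<bar>zero_ext \<Omega> u y - zero_ext \<Omega> u x\<bar> * \<mu> {x, y}"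
  have "infsum ?f (ordered_adj_pairs V E) = infsum ?f (incident_pairs V E \<Omega>)"
    by (intro infsum_cong_neutral) (auto simp: incident_pairs_def zero_ext_def split: if_splits)
  also have "\<dots> = sum ?f (incident_pairs V E \<Omega>)"
    using finite_incident_pairs[OF assms] by simp
  finally show ?thesis
    by (simp add: energy1_def)
qed

lemma energy1_abs_le:
  assumes "finite \<Omega>" "\<Omega> \<subseteq> V"
  shows "energy1 V E \<mu> \<Omega> (\<lambda>x. \<bar>u x\<bar>) \<le> energy1 V E \<mu> \<Omega> u"
proof -
  have "\<bar>zero_ext \<Omega> (\<lambda>x. \<bar>u x\<bar>) y - zero_ext \<Omega> (\<lambda>x. \<bar>u x\<bar>) x\<bar> * \<mu> {x, y}
      \<le> \<bar>zero_ext \<Omega> u y - zero_ext \<Omega> u x\<bar> * \<mu> {x, y}"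
    if "(x, y) \<in> incident_pairs V E \<Omega>" for x y
  proof (rule mult_right_mono)
    show "0 \<le> \<mu> {x, y}"
      using that edge_weight_pos[of "{x, y}"]
      by (auto simp: incident_pairs_def ordered_adj_pairs_def)
  qed (auto simp: zero_ext_def)
  then show ?thesis
    unfolding energy1_eq_finite_sum[OF assms] by (intro mult_left_mono sum_mono) auto
qed

text \<open>
  Each boundary edge \<open>{x, y}\<close> has exactly one orientation that leaves \<open>U\<close> and exactly one that
  enters \<open>U\<close>; the indicator jumps by \<open>1\<close> along both and is constant along every other edge.
\<close>

lemma energy1_indicator:
  assumes "finite \<Omega>" "\<Omega> \<subseteq> V" "U \<subseteq> \<Omega>"
  shows "energy1 V E \<mu> \<Omega> (indicator U) = (\<Sum>e\<in>edge_boundary V E U. \<mu> e)"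
proof -
  let ?P = "incident_pairs V E \<Omega>"
  let ?f = "\<lambda>(x, y). \<mu> {x, y}"
  define Out where "Out = {(x, y) \<in> ?P. x \<in> U \<and> y \<notin> U}"
  define In where "In = {(x, y) \<in> ?P. x \<notin> U \<and> y \<in> U}"
  have fin: "finite Out" "finite In"
    by (rule finite_subset[OF _ finite_incident_pairs[OF assms(1,2)]]; auto simp: Out_def In_def)+
  have "(\<Sum>(x, y)\<in>?P. \<bar>zero_ext \<Omega> (indicator U) y - zero_ext \<Omega> (indicator U) x\<bar> * \<mu> {x, y})
      = sum ?f (Out \<union> In)"
  proof (rule sum.mono_neutral_cong_right)
    show "finite ?P"
      by (rule finite_incident_pairs[OF assms(1,2)])
  qed (use assms(3) in \<open>auto simp: Out_def In_def zero_ext_def indicator_def split: if_splits\<close>)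
  also have "\<dots> = sum ?f Out + sum ?f In"
    using fin by (intro sum.union_disjoint) (auto simp: Out_def In_def)
  also have "sum ?f Out = (\<Sum>e\<in>edge_boundary V E U. \<mu> e)"
  proof -
    have "bij_betw (\<lambda>(x, y). {x, y}) Out (edge_boundary V E U)"
      unfolding bij_betw_def
    proof
      show "inj_on (\<lambda>(x, y). {x, y}) Out"
        by (auto simp: inj_on_def Out_def doubleton_eq_iff)
      show "(\<lambda>(x, y). {x, y}) ` Out = edge_boundary V E U"
        using assms(2,3)
        by (fastforce simp: Out_def incident_pairs_def ordered_adj_pairs_def edge_boundary_def)
    qed
    from sum.reindex_bij_betw[OF this, of \<mu>] show ?thesis
      by (simp add: case_prod_unfold)
  qed
  also have "sum ?f In = sum ?f Out"
    by (rule sum.reindex_bij_witness[where i = prod.swap and j = prod.swap])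
       (auto simp: Out_def In_def incident_pairs_def ordered_adj_pairs_def insert_commute)
  also have "sum ?f Out = (\<Sum>e\<in>edge_boundary V E U. \<mu> e)"
    by fact
  finally show ?thesis
    by (simp add: energy1_eq_finite_sum[OF assms(1,2)])
qed

text \<open>
  Along every edge, the jump of \<open>u\<close> is the sum of the jump of the removed layer and the jump of the
  remainder. Inside \<open>U \<inter> \<Omega>\<close> the layer is constant; across the boundary of this set the two jumps do
  not have opposite signs, because the remainder is nonnegative inside and vanishes outside.
\<close>

lemma energy1_remove_layer:
  assumes "finite \<Omega>" "\<Omega> \<subseteq> V" "0 \<le> m"
    and "\<And>x. x \<in> U \<Longrightarrow> m \<le> u x" "\<And>x. x \<in> \<Omega> - U \<Longrightarrow> u x = 0"
  shows "energy1 V E \<mu> \<Omega> u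
    = m * energy1 V E \<mu> \<Omega> (indicator U) + energy1 V E \<mu> \<Omega> (\<lambda>x. u x - m * indicator U x)"
proof -
  let ?z = "zero_ext \<Omega>"
  let ?v = "\<lambda>x. u x - m * indicator U x"
  have vertex: "?z u x = m + ?z ?v x \<and> ?z (indicator U) x = (1::real) \<and> 0 \<le> ?z ?v x
      \<or> ?z u x = 0 \<and> ?z (indicator U) x = (0::real) \<and> ?z ?v x = 0" for x
    using assms(4)[of x] assms(5)[of x]
    by (cases "x \<in> \<Omega>"; cases "x \<in> U") (simp_all add: zero_ext_def)
  have "\<bar>?z u y - ?z u x\<bar>
      = m * \<bar>?z (indicator U) y - ?z (indicator U) x\<bar> + \<bar>?z ?v y - ?z ?v x\<bar>" for x y
    using vertex[of x] vertex[of y] \<open>0 \<le> m\<close> by (elim disjE) simp_all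
  then have "(\<Sum>(x, y)\<in>incident_pairs V E \<Omega>. \<bar>?z u y - ?z u x\<bar> * \<mu> {x, y})
      = m * (\<Sum>(x, y)\<in>incident_pairs V E \<Omega>. \<bar>?z (indicator U) y - ?z (indicator U) x\<bar> * \<mu> {x, y})
        + (\<Sum>(x, y)\<in>incident_pairs V E \<Omega>. \<bar>?z ?v y - ?z ?v x\<bar> * \<mu> {x, y})"
    by (simp add: sum_distrib_left sum.distrib[symmetric] case_prod_unfold algebra_simps)
  then show ?thesis
    by (simp add: energy1_eq_finite_sum[OF assms(1,2)] algebra_simps)
qed

lemma cheeger_constant_le:
  assumes "finite \<Omega>" "\<Omega> \<subseteq> V" "U \<noteq> {}" "U \<subseteq> \<Omega>"
  shows "cheeger_constant V E \<nu> \<mu> \<Omega> * (\<Sum>x\<in>U. \<nu> x) \<le> (\<Sum>e\<in>edge_boundary V E U. \<mu> e)"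
proof -
  have "(\<Sum>x\<in>U. \<nu> x) > 0"
    using assms vertex_measure_pos by (intro sum_pos) (auto intro: finite_subset)
  moreover have "cheeger_constant V E \<nu> \<mu> \<Omega>
      \<le> (\<Sum>e\<in>edge_boundary V E U. \<mu> e) / (\<Sum>x\<in>U. \<nu> x)"
    unfolding cheeger_constant_def using assms by (intro Min_le) auto
  ultimately show ?thesis
    by (simp add: pos_le_divide_eq)
qed

text \<open>
  Induction on the size of the support: a layer whose height is the least positive value of the
  function empties the points where that value is attained and no others.
\<close>

lemma cheeger_inequality_nonneg:
  assumes "finite \<Omega>" "\<Omega> \<subseteq> V" "\<And>x. x \<in> \<Omega> \<Longrightarrow> 0 \<le> u x"
  shows "cheeger_constant V E \<nu> \<mu> \<Omega> * norm1 \<nu> \<Omega> u \<le> energy1 V E \<mu> \<Omega> u"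
  using assms(3)
proof (induction "card {x \<in> \<Omega>. u x \<noteq> 0}" arbitrary: u rule: less_induct)
  case less
  let ?h = "cheeger_constant V E \<nu> \<mu> \<Omega>"
  define U where "U = {x \<in> \<Omega>. u x \<noteq> 0}"
  have U: "finite U" "U \<subseteq> \<Omega>"
    using assms(1) unfolding U_def by auto
  show ?case
  proof (cases "U = {}")
    case True
    then have "\<And>x. x \<in> \<Omega> \<Longrightarrow> u x = 0"
      by (auto simp: U_def)
    then have "norm1 \<nu> \<Omega> u = 0" "zero_ext \<Omega> u = (\<lambda>x. 0)"
      by (auto simp: norm1_def zero_ext_def)
    then show ?thesis
      by (simp add: energy1_def case_prod_unfold)
  next
    case False
    define m where "m = Min (u ` U)"
    have "m \<in> u ` U"
      unfolding m_def using U False by (intro Min_in) auto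
    then obtain a where a: "a \<in> U" "u a = m"
      by auto
    have m_le: "m \<le> u x" if "x \<in> U" for x
      unfolding m_def using U that by (intro Min_le) auto
    have "0 \<le> m"
      using a U less.prems by auto
    have u_zero: "u x = 0" if "x \<in> \<Omega> - U" for x
      using that by (simp add: U_def)
    define v where "v = (\<lambda>x. u x - m * indicator U x)"
    have "0 \<le> v x" if "x \<in> \<Omega>" for x
      using that m_le[of x] less.prems[of x] by (cases "x \<in> U") (auto simp: v_def)
    moreover have "card {x \<in> \<Omega>. v x \<noteq> 0} < card U"
    proof (rule psubset_card_mono)
      have "a \<notin> {x \<in> \<Omega>. v x \<noteq> 0}"
        using a by (simp add: v_def)
      moreover have "{x \<in> \<Omega>. v x \<noteq> 0} \<subseteq> U"
        by (auto simp: v_def U_def indicator_def)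
      ultimately show "{x \<in> \<Omega>. v x \<noteq> 0} \<subset> U"
        using a(1) by blast
    qed (rule U)
    ultimately have IH: "?h * norm1 \<nu> \<Omega> v \<le> energy1 V E \<mu> \<Omega> v"
      using less.hyps[of v] by (simp add: U_def)
    have "?h * norm1 \<nu> \<Omega> u = m * (?h * (\<Sum>x\<in>U. \<nu> x)) + ?h * norm1 \<nu> \<Omega> v"
      using norm1_remove_layer[where u = u, OF assms(1) U(2) \<open>0 \<le> m\<close> m_le]
      by (simp add: v_def algebra_simps)
    also have "\<dots> \<le> m * (\<Sum>e\<in>edge_boundary V E U. \<mu> e) + energy1 V E \<mu> \<Omega> v"
      using cheeger_constant_le[OF assms(1,2) False U(2)] \<open>0 \<le> m\<close> IH
      by (intro add_mono mult_left_mono)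
    also have "\<dots> = energy1 V E \<mu> \<Omega> u"
      using energy1_remove_layer[where u = u, OF assms(1,2) \<open>0 \<le> m\<close> m_le u_zero]
        energy1_indicator[OF assms(1,2) U(2)]
      by (simp add: v_def)
    finally show ?thesis .
  qed
qed

lemma cheeger_inequality:
  assumes "finite \<Omega>" "\<Omega> \<subseteq> V"
  shows "cheeger_constant V E \<nu> \<mu> \<Omega> * norm1 \<nu> \<Omega> u \<le> energy1 V E \<mu> \<Omega> u"
proof -
  have "cheeger_constant V E \<nu> \<mu> \<Omega> * norm1 \<nu> \<Omega> (\<lambda>x. \<bar>u x\<bar>) \<le> energy1 V E \<mu> \<Omega> (\<lambda>x. \<bar>u x\<bar>)"
    by (rule cheeger_inequality_nonneg[OF assms]) simp
  also have "\<dots> \<le> energy1 V E \<mu> \<Omega> u"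
    by (rule energy1_abs_le[OF assms])
  finally show ?thesis
    by (simp add: norm1_def)
qed

lemma norm1_pos:
  assumes "finite \<Omega>" "\<Omega> \<subseteq> V" "\<exists>x\<in>\<Omega>. u x \<noteq> 0"
  shows "norm1 \<nu> \<Omega> u > 0"
proof -
  obtain a where "a \<in> \<Omega>" "u a \<noteq> 0"
    using assms(3) by blast
  moreover have "0 < \<nu> x" if "x \<in> \<Omega>" for x
    using that assms(2) vertex_measure_pos by blast
  ultimately show ?thesis
    unfolding norm1_def using assms(1)
    by (intro sum_pos2[of _ a]) (simp_all add: less_imp_le)
qed

end

theorem proposition1p1:
  fixes V :: "'a set" and E :: "'a set set"
    and \<nu> :: "'a \<Rightarrow> real" and \<mu> :: "'a set \<Rightarrow> real" and \<Omega> :: "'a set"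
  assumes "weighted_graph V E \<nu> \<mu>"
    and "\<Omega> \<subseteq> V" and "finite \<Omega>" and "\<Omega> \<noteq> {}"
  shows "dirichlet_lambda11 V E \<nu> \<mu> \<Omega> = cheeger_constant V E \<nu> \<mu> \<Omega>"
proof -
  interpret weighted_graph V E \<nu> \<mu>
    by fact
  let ?h = "cheeger_constant V E \<nu> \<mu> \<Omega>"
  let ?R = "\<lambda>u. energy1 V E \<mu> \<Omega> u / norm1 \<nu> \<Omega> u"
  let ?A = "{u \<in> \<Omega> \<rightarrow>\<^sub>E UNIV. \<exists>x\<in>\<Omega>. u x \<noteq> (0::real)}"
  have lower: "?h \<le> ?R u" if "u \<in> ?A" for u
    using that cheeger_inequality[OF assms(3,2), of u] norm1_pos[OF assms(3,2), of u]
    by (simp add: pos_le_divide_eq)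
  obtain U where U: "U \<noteq> {}" "U \<subseteq> \<Omega>"
      "?h = (\<Sum>e\<in>edge_boundary V E U. \<mu> e) / (\<Sum>x\<in>U. \<nu> x)"
    using cheeger_constant_attained[OF assms(3,4)] .
  (* The infimum ranges over extensional functions, so the indicator must be restricted to \<Omega>. *)
  define w :: "'a \<Rightarrow> real" where "w = restrict (indicator U) \<Omega>"
  have w: "w \<in> ?A"
    using U(1,2) by (fastforce simp: w_def indicator_def)
  have "zero_ext \<Omega> w = zero_ext \<Omega> (indicator U)" "norm1 \<nu> \<Omega> w = norm1 \<nu> \<Omega> (indicator U)"
    by (auto simp: w_def zero_ext_def norm1_def)
  then have "?R w = ?R (indicator U)"
    by (simp add: energy1_def)
  also have "\<dots> = ?h"
    using U by (simp only: energy1_indicator[OF assms(3,2) U(2)] norm1_indicator[OF assms(3) U(2)])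
  finally have "?R w = ?h" .
  show ?thesis
    unfolding dirichlet_lambda11_def
  proof (rule antisym)
    have "bdd_below (?R ` ?A)"
      using lower by (intro bdd_belowI2)
    then have "(INF u\<in>?A. ?R u) \<le> ?R w"
      using w by (rule cINF_lower)
    then show "(INF u\<in>?A. ?R u) \<le> ?h"
      by (simp only: \<open>?R w = ?h\<close>)
    show "?h \<le> (INF u\<in>?A. ?R u)"
      using w lower by (intro cINF_greatest) auto
  qed
qed

end
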